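(* Let $n$ be a positive odd integer and let $Q=(\mathbb{Z}_n,\circ)$, where $r\circ s=2s-r \bmod n$. If $H\leq Q$ is a subquasigroup, then $|H|$ divides $|Q|$. Hence, if $Q$ has prime order and $H\leq Q$, then $H=\langle x\rangle$ for some $x\in Q$ or $H=Q$.
   Context: $\mathbb{Z}_n=\{0,1,\ldots,n-1\}$ denotes the integers modulo $n$. For odd $n$, $(\mathbb{Z}_n,\circ)$ is a quasigroup, i.e. for all $a,b$ the equations $a\circ x=b$ and $y\circ a=b$ have unique solutions. $H\leq Q$ means that $H$ is a subquasigroup of $Q$: a nonempty subset that is closed under $\circ$ and is itself a quasigroup under $\circ$. $\langle x\rangle$ denotes the subquasigroup generated by $x$ (which is $\{x\}$, since $x\circ x=x$). *)

theory Defs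
  imports "HOL-Number_Theory.Number_Theory"
begin

definition quasigroup_on :: "'a set \<Rightarrow> ('a \<Rightarrow> 'a \<Rightarrow> 'a) \<Rightarrow> bool" where
  "quasigroup_on Q f \<longleftrightarrow>
     (\<forall>a\<in>Q. \<forall>b\<in>Q. f a b \<in> Q) \<and>
     (\<forall>a\<in>Q. \<forall>b\<in>Q. (\<exists>!x. x \<in> Q \<and> f a x = b) \<and> (\<exists>!y. y \<in> Q \<and> f y a = b))"

definition subquasigroup :: "'a set \<Rightarrow> 'a set \<Rightarrow> ('a \<Rightarrow> 'a \<Rightarrow> 'a) \<Rightarrow> bool" where
  "subquasigroup H Q f \<longleftrightarrow> H \<noteq> {} \<and> H \<subseteq> Q \<and> quasigroup_on H f"

definition generated_subquasigroup :: "'a set \<Rightarrow> ('a \<Rightarrow> 'a \<Rightarrow> 'a) \<Rightarrow> 'a set \<Rightarrow> 'a set" where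
  "generated_subquasigroup Q f X = \<Inter> {H. subquasigroup H Q f \<and> X \<subseteq> H}"

text \<open>The integers modulo \<open>n\<close> are represented by their least nonnegative residues in
  \<^typ>\<open>int\<close>, so that the subtraction in \<open>2s - r\<close> is not truncated.\<close>

definition Zmod :: "nat \<Rightarrow> int set" where
  "Zmod n = {0..<int n}"

definition circ :: "nat \<Rightarrow> int \<Rightarrow> int \<Rightarrow> int" where
  "circ n r s = (2 * s - r) mod int n"

lemma quasigroup_on_Zmod:
  assumes "odd n"
  shows "quasigroup_on (Zmod n) (circ n)"
proof -
  let ?n = "int n"
  have n: "?n > 0" using assms by (simp add: odd_pos)
  have cop: "coprime 2 ?n" using assms by simp
  have "odd ?n" using assms by simp
  then obtain k where k: "?n = 2 * k + 1" by (rule oddE)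
  have closed: "circ n a b \<in> Zmod n" for a b
    using n by (simp add: circ_def Zmod_def)
  have mod_id: "b mod ?n = b" if "b \<in> Zmod n" for b
    using that by (simp add: Zmod_def)
  have eq_iff: "x mod ?n = b \<longleftrightarrow> ?n dvd x - b" if "b \<in> Zmod n" for x b
    using mod_eq_dvd_iff[of x ?n b] mod_id[OF that] by simp
  have uniq: "x = y" if "x \<in> Zmod n" "y \<in> Zmod n" "?n dvd x - y" for x y
    using eq_iff[OF that(2), of x] mod_id[OF that(1)] that(3) by simp
  have left: "\<exists>!x. x \<in> Zmod n \<and> circ n a x = b" if ab: "a \<in> Zmod n" "b \<in> Zmod n" for a b
  proof (rule ex1I)
    let ?x = "((a + b) * (k + 1)) mod ?n"
    have "[2 * ?x - a = 2 * ((a + b) * (k + 1)) - a] (mod ?n)"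
      by (intro cong_diff cong_mult cong_refl cong_refl) (simp add: cong_def)
    moreover have "2 * ((a + b) * (k + 1)) - a - b = ?n * (a + b)"
      unfolding k by (simp add: algebra_simps)
    then have "[2 * ((a + b) * (k + 1)) - a = b] (mod ?n)"
      unfolding cong_iff_dvd_diff by (metis dvd_triv_left)
    ultimately have "[2 * ?x - a = b] (mod ?n)" by (rule cong_trans)
    then have sol: "circ n a ?x = b"
      using ab(2) mod_id[of b] by (simp only: circ_def cong_def)
    have mem: "?x \<in> Zmod n" using n by (simp add: Zmod_def)
    from mem sol show "?x \<in> Zmod n \<and> circ n a ?x = b" by (rule conjI)
    fix y assume y: "y \<in> Zmod n \<and> circ n a y = b"
    have "?n dvd 2 * ?x - a - b" "?n dvd 2 * y - a - b"
      using sol y eq_iff[OF ab(2)] unfolding circ_def by blast+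
    then have "?n dvd (2 * y - a - b) - (2 * ?x - a - b)" by (rule dvd_diff[rotated])
    moreover have "(2 * y - a - b) - (2 * ?x - a - b) = 2 * (y - ?x)" by simp
    ultimately have "?n dvd 2 * (y - ?x)" by (simp only:)
    then have "?n dvd y - ?x"
      using coprime_dvd_mult_right_iff[of ?n 2 "y - ?x"] cop coprime_commute[of 2 ?n]
      by (simp only:)
    then show "y = ?x" using uniq mem y by blast
  qed
  have right: "\<exists>!y. y \<in> Zmod n \<and> circ n y a = b" if ab: "a \<in> Zmod n" "b \<in> Zmod n" for a b
  proof (rule ex1I)
    let ?y = "(2 * a - b) mod ?n"
    have "(2 * a - ?y) mod ?n = b mod ?n" by (simp add: mod_diff_right_eq)
    then have "circ n ?y a = b" using mod_id[OF ab(2)] by (simp only: circ_def)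
    moreover have "?y \<in> Zmod n" using n by (simp add: Zmod_def)
    ultimately show "?y \<in> Zmod n \<and> circ n ?y a = b" by (intro conjI)
    fix y assume y: "y \<in> Zmod n \<and> circ n y a = b"
    then have "?n dvd 2 * a - y - b" using eq_iff[OF ab(2)] unfolding circ_def by blast
    moreover have "2 * a - y - b = 2 * a - b - y" by simp
    ultimately have "?n dvd 2 * a - b - y" by (simp only:)
    then show "y = ?y" using eq_iff[of y "2 * a - b"] y by simp
  qed
  show ?thesis
    unfolding quasigroup_on_def by (intro conjI ballI closed left right)
qed

end

theory Submission imports Defs begin

text \<open>
  The element \<open>r \<circ> s = 2s - r\<close> is the reflection of \<open>r\<close> in the point \<open>s\<close>.  Let \<open>H\<close> be a
  subquasigroup, choose \<open>h \<in> H\<close>, and let \<open>G\<close> be the set of all integers \<open>z\<close> for which the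
  residue of \<open>h + z\<close> lies in \<open>H\<close>.  Then \<open>G\<close> contains \<open>0\<close> and \<open>n\<close> and is closed under reflections
  of the integer line.  Reflecting in two points of \<open>G\<close> at distance \<open>d\<close>, one after the
  other, is the translation by \<open>2d\<close>; taking for \<open>d\<close> the least positive element of \<open>G\<close>, a
  division with remainder by \<open>2d\<close> gives \<open>G = d\<int>\<close> (lemma \<open>reflection_closed_int_set\<close>).  Hence \<open>d\<close>
  divides \<open>n\<close> and \<open>H\<close> is a single residue class modulo \<open>d\<close> inside \<open>\<int>\<^sub>n\<close>, which has \<open>n / d\<close>
  elements (lemma \<open>card_residue_class\<close>).

  If \<open>n\<close> is prime, \<open>H\<close> has either \<open>n\<close> elements, so that it is everything, or one element, and
  a one-element subquasigroup \<open>{x}\<close> is generated by \<open>x\<close>.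
\<close>

text \<open>
  A reflection-closed set through \<open>0\<close> is invariant under translation by twice any of its elements,
  so every element can be reduced modulo \<open>2d\<close>, where \<open>d\<close> is its least positive element.  A
  remainder strictly between \<open>0\<close> and \<open>d\<close> contradicts minimality at once, and one strictly between
  \<open>d\<close> and \<open>2d\<close> does so after reflection in \<open>d\<close>.
\<close>

lemma reflection_closed_int_set:
  fixes G :: "int set"
  assumes zero: "0 \<in> G"
    and refl: "\<And>a b. a \<in> G \<Longrightarrow> b \<in> G \<Longrightarrow> 2 * b - a \<in> G"
    and pos: "\<exists>p\<in>G. p > 0"
  shows "\<exists>d>0. G = {z. d dvd z}"
proof -
  from pos obtain p where p: "p \<in> G" "p > 0" by blast
  define m where "m = (LEAST k. k > 0 \<and> int k \<in> G)"
  define d where "d = int m"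
  have ex: "nat p > 0 \<and> int (nat p) \<in> G" using p by simp
  have m: "m > 0 \<and> int m \<in> G" unfolding m_def by (rule LeastI) (rule ex)
  then have d: "d > 0" "d \<in> G" by (simp_all add: d_def)
  have least: "d \<le> z" if "z \<in> G" "z > 0" for z
  proof -
    have "m \<le> nat z" unfolding m_def by (rule Least_le) (use that in simp)
    then show ?thesis using that by (simp add: d_def)
  qed
  have neg: "- z \<in> G" if "z \<in> G" for z using refl[OF that zero] by simp
  have shift_nat: "z + 2 * d * int k \<in> G" if "z \<in> G" for z k
  proof (induction k)
    case (Suc k)
    then show ?case using refl[OF neg[OF Suc] d(2)] by (simp add: algebra_simps)
  qed (use that in simp)
  have shift: "z + 2 * d * k \<in> G" if "z \<in> G" for z k
  proof (cases "k \<ge> 0")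
    case True
    then show ?thesis using shift_nat[OF that, of "nat k"] by simp
  next
    case False
    then show ?thesis using neg[OF shift_nat[OF neg[OF that], of "nat (- k)"]] by (simp add: add.commute)
  qed
  have "d dvd z" if z: "z \<in> G" for z
  proof -
    define r where "r = z mod (2 * d)"
    have r: "0 \<le> r" "r < 2 * d" using d by (simp_all add: r_def)
    have rG: "r \<in> G" using shift[OF z, of "- (z div (2 * d))"]
      by (simp add: r_def minus_mult_div_eq_mod)
    have "r = 0 \<or> r = d" using least[OF rG] least[OF refl[OF rG d(2)]] r by linarith
    then have "d dvd r" by auto
    then show ?thesis by (simp add: r_def dvd_mod_iff)
  qed
  moreover have "z \<in> G" if dz: "d dvd z" for z
  proof -
    obtain k where k: "z = d * k" using dz by (rule dvdE)
    show ?thesis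
    proof (cases "even k")
      case True
      then obtain j where "k = 2 * j" by (rule evenE)
      then show ?thesis using shift[OF zero, of j] k by (simp add: algebra_simps)
    next
      case False
      then obtain j where "k = 2 * j + 1" by (rule oddE)
      then show ?thesis using shift[OF d(2), of j] k by (simp add: algebra_simps)
    qed
  qed
  ultimately show ?thesis using d(1) by blast
qed

lemma card_residue_class:
  fixes d h n :: int
  assumes d: "d > 0" and dvd: "d dvd n"
  shows "card {z \<in> {0..<n}. d dvd z - h} = nat (n div d)"
proof -
  obtain k where k: "n = d * k" using dvd by (rule dvdE)
  define r where "r = h mod d"
  have r: "0 \<le> r" "r < d" using d by (simp_all add: r_def)
  have "{z \<in> {0..<n}. d dvd z - h} = (\<lambda>j. d * j + r) ` {0..<k}"
  proof (intro equalityI subsetI)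
    fix z assume z: "z \<in> {z \<in> {0..<n}. d dvd z - h}"
    then have "z mod d = r" by (simp add: r_def mod_eq_dvd_iff)
    then have eq: "z = d * (z div d) + r" by (metis mult_div_mod_eq)
    have "0 \<le> z div d" using z d by (simp add: pos_imp_zdiv_nonneg_iff)
    moreover have "z < d * k" using z k by simp
    then have "d * (z div d) < d * k" using eq r by linarith
    then have "z div d < k" using d by simp
    ultimately have "z div d \<in> {0..<k}" by simp
    with eq show "z \<in> (\<lambda>j. d * j + r) ` {0..<k}" by (rule image_eqI)
  next
    fix z assume "z \<in> (\<lambda>j. d * j + r) ` {0..<k}"
    then obtain j where j: "0 \<le> j" "j < k" "z = d * j + r" by auto
    have "d * (j + 1) \<le> d * k" using j d by (intro mult_left_mono) auto
    then have "z < n" using j r k by (simp add: algebra_simps)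
    moreover have "0 \<le> z" using j d r by simp
    moreover have "z mod d = h mod d" using j by (simp add: r_def)
    ultimately show "z \<in> {z \<in> {0..<n}. d dvd z - h}" by (simp add: mod_eq_dvd_iff)
  qed
  moreover have "inj_on (\<lambda>j. d * j + r) {0..<k}" using d by (intro inj_onI) simp
  ultimately show ?thesis using k d by (simp add: card_image)
qed

lemma card_Zmod: "card (Zmod n) = n"
  by (simp add: Zmod_def)

text \<open>
  Pulling \<open>H\<close> back to the integers removes the reduction modulo \<open>n\<close>, so that there is a least
  positive element to work with; the pullback is shifted by a point \<open>h\<close> of \<open>H\<close> to pass
  through \<open>0\<close>.  Being \<open>n\<close>-periodic it contains \<open>n\<close>, which is why the step \<open>d\<close> divides \<open>n\<close>.
\<close>

lemma subquasigroup_circ_residue_class: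
  assumes n: "n > 0" and H: "subquasigroup H (Zmod n) (circ n)"
  shows "\<exists>d>0. \<exists>h. d dvd int n \<and> H = {z \<in> {0..<int n}. d dvd z - h}"
proof -
  have sub: "H \<subseteq> {0..<int n}" and closed: "\<And>a b. a \<in> H \<Longrightarrow> b \<in> H \<Longrightarrow> circ n a b \<in> H"
    using H by (auto simp: subquasigroup_def quasigroup_on_def Zmod_def)
  obtain h where h: "h \<in> H" using H by (auto simp: subquasigroup_def)
  define G where "G = {z. (h + z) mod int n \<in> H}"
  have "0 \<in> G" "int n \<in> G" using h sub by (auto simp: G_def)
  moreover have "2 * b - a \<in> G" if "a \<in> G" "b \<in> G" for a b
  proof -
    have "circ n ((h + a) mod int n) ((h + b) mod int n) = (2 * (h + b) - (h + a)) mod int n"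
      unfolding circ_def cong_def[symmetric]
      by (intro cong_diff cong_mult) (simp_all add: cong_def)
    also have "2 * (h + b) - (h + a) = h + (2 * b - a)" by simp
    finally show ?thesis
      using closed[of "(h + a) mod int n" "(h + b) mod int n"] that by (simp add: G_def)
  qed
  ultimately obtain d where d: "d > 0" "G = {z. d dvd z}"
    using reflection_closed_int_set[of G] n by force
  have "z \<in> H \<longleftrightarrow> d dvd z - h" if "z \<in> {0..<int n}" for z
  proof -
    have "z \<in> H \<longleftrightarrow> z - h \<in> G" using that by (simp add: G_def)
    then show ?thesis using d by simp
  qed
  then have "H = {z \<in> {0..<int n}. d dvd z - h}" using sub by blast
  moreover have "d dvd int n" using \<open>int n \<in> G\<close> d by simp
  ultimately show ?thesis using d(1) by blast
qed

lemma card_subquasigroup_circ_dvd: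
  assumes "n > 0" and "subquasigroup H (Zmod n) (circ n)"
  shows "card H dvd n"
proof -
  obtain d h where d: "d > 0" "d dvd int n" and H: "H = {z \<in> {0..<int n}. d dvd z - h}"
    using subquasigroup_circ_residue_class[OF assms] by blast
  have "int (card H) = int n div d"
    using d card_residue_class[of d "int n" h] by (simp add: H pos_imp_zdiv_nonneg_iff)
  then have "int (card H) * d = int n" using d(2) by simp
  then have "int (card H) dvd int n" by (metis dvd_triv_left)
  then show ?thesis by simp
qed

lemma generated_subquasigroup_eq_singleton:
  assumes "subquasigroup {x} Q f"
  shows "generated_subquasigroup Q f {x} = {x}"
  using assms by (auto simp: generated_subquasigroup_def)

theorem theorem2p14:
  fixes n :: nat
  assumes "n > 0" and "odd n"
  shows "(\<forall>H. subquasigroup H (Zmod n) (circ n) \<longrightarrow> card H dvd card (Zmod n)) \<and>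
    (prime (card (Zmod n)) \<longrightarrow>
      (\<forall>H. subquasigroup H (Zmod n) (circ n) \<longrightarrow>
        (\<exists>x\<in>Zmod n. H = generated_subquasigroup (Zmod n) (circ n) {x}) \<or> H = Zmod n))"
proof (intro conjI allI impI)
  fix H assume "subquasigroup H (Zmod n) (circ n)"
  then show "card H dvd card (Zmod n)"
    using card_subquasigroup_circ_dvd assms(1) by (simp add: card_Zmod)
next
  fix H assume prime: "prime (card (Zmod n))" and H: "subquasigroup H (Zmod n) (circ n)"
  have sub: "H \<subseteq> Zmod n" using H by (simp add: subquasigroup_def)
  have "card H dvd n" using card_subquasigroup_circ_dvd assms(1) H by blast
  then consider "card H = 1" | "card H = n"
    using prime by (auto simp: card_Zmod prime_nat_iff)
  then show "(\<exists>x\<in>Zmod n. H = generated_subquasigroup (Zmod n) (circ n) {x}) \<or> H = Zmod n"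
  proof cases
    case 1
    then obtain x where x: "H = {x}" by (rule card_1_singletonE)
    then have "H = generated_subquasigroup (Zmod n) (circ n) {x}"
      using generated_subquasigroup_eq_singleton[of x "Zmod n" "circ n"] H by simp
    moreover have "x \<in> Zmod n" using x sub by simp
    ultimately show ?thesis by (intro disjI1 bexI)
  next
    case 2
    then have "H = Zmod n" using sub by (intro card_subset_eq) (simp_all add: Zmod_def)
    then show ?thesis ..
  qed
qed

end
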